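(* Let $L^*$ be the number of compressed layers of a sparse binary neural network (SBNN), indexed by $\ell\in\{1,\dots,L^*\}$. Let the weights of layer $\ell$ form a $D_\ell$-dimensional random array with entries in $\{0,1\}$, with dimension sizes $n^{(\ell)}_1,\dots,n^{(\ell)}_{D_\ell}$ and total number of weights $N_\ell=\prod_{j=1}^{D_\ell} n^{(\ell)}_j$. Let $\mathrm{EC}\in[0,1]$ be the network's fraction of expected connections. Assume that (i) every weight $w'_i$ follows a Bernoulli distribution with parameter $\mathrm{EC}$, i.e. $P(w'_i=1)=\mathrm{EC}$; and (ii) in every layer $\ell$ the fraction of one-valued weights equals $\mathrm{EC}$. For each layer $\ell$, let $n^{(\ell)}_d$ be the size of the dimension $d\in\{1,\dots,D_\ell\}$ along which the index encoding is performed, and let $$n^{(\ell)}_{\text{bits,IE}}=\left\lceil \log_2\left(n^{(\ell)}_d\right)\right\rceil$$ be the number of bits used to encode the index of each single one-valued weight. Then the expected total size in bits $\mathcal{W}_{\mathrm{SBNN,IE}}$ of the SBNN's weights encoded with the index encoder (IE) is $$\mathcal{W}_{\mathrm{SBNN,IE}}=\sum_{\ell=1}^{L^*}\left( n^{(\ell)}_{\text{bits,IE}}\cdot \mathrm{EC}\cdot N_\ell+\left(n^{(\ell)}_{\text{bits,IE}}+1\right)\cdot\frac{N_\ell}{n^{(\ell)}_d}+16\cdot D_\ell+32\cdot 2\right).$$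
   Context: A sparse binary neural network (SBNN) is a neural network in which the weights of each layer take one of two real values and are represented by binary weights $w'_i\in\{0,1\}$ through $w_i=(w'_i+\alpha')\cdot\beta'$. Here $\alpha',\beta'\in\mathbb{R}$ are two learned parameters of the layer, written $\alpha'^{(\ell)},\beta'^{(\ell)}$ for layer $\ell$. The fraction of expected connections $\mathrm{EC}$ is the targeted fraction of one-valued weights in the network. Index encoder (IE). Fix for layer $\ell$ a dimension $d$ of its weight array, of size $n^{(\ell)}_d$ (for a weight matrix one may take $d=2$, so that the one-dimensional slices are the matrix rows and the indices are column indices). The array is split into its $N_\ell/n^{(\ell)}_d$ one-dimensional slices of length $n^{(\ell)}_d$ along dimension $d$. The encoding of layer $\ell$ stores the following. (a) For every one-valued weight, its index within its slice, using $n^{(\ell)}_{\text{bits,IE}}=\lceil\log_2(n^{(\ell)}_d)\rceil$ bits. (b) For every slice (including slices with no one-valued weight), as a delimiter, the number of one-valued weights it contains. This is an integer between $0$ and $n^{(\ell)}_d$, and it is stored using $n^{(\ell)}_{\text{bits,IE}}+1$ bits. (c) The size of each of the $D_\ell$ dimensions, using $16$ bits per dimension. (d) The two learned parameters $\alpha'^{(\ell)}$ and $\beta'^{(\ell)}$, using $32$ bits each. The encoded size of a layer is the total number of bits stored in (a)–(d), and the encoded size of the network is the sum over its $L^*$ compressed layers. *)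

theory Defs
  imports "HOL-Probability.Probability" "HOL-Library.Multiset"
begin

text \<open>
  A \<open>D\<close>-dimensional array with dimension sizes \<open>n 1, \<dots>, n D\<close> is a function on multi-indices.
  Dimensions are numbered from 1, positions within a dimension from 0, so that a position along
  a dimension of size \<open>m\<close> fits into \<open>\<lceil>log 2 m\<rceil>\<close> bits.
\<close>

definition array_indices :: "nat \<Rightarrow> (nat \<Rightarrow> nat) \<Rightarrow> (nat \<Rightarrow> nat) set" where
  "array_indices D n = (\<Pi>\<^sub>E j\<in>{1..D}. {..<n j})"

text \<open>
  A slice along dimension \<open>d\<close> is the set of all multi-indices obtained from a given one
  by letting only its \<open>d\<close>-th component vary.
\<close>

definition slices :: "nat \<Rightarrow> (nat \<Rightarrow> nat) \<Rightarrow> nat \<Rightarrow> (nat \<Rightarrow> nat) set set" where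
  "slices D n d = (\<lambda>i. (\<lambda>k. i(d := k)) ` {..<n d}) ` array_indices D n"

definition ones :: "((nat \<Rightarrow> nat) \<Rightarrow> nat) \<Rightarrow> (nat \<Rightarrow> nat) set \<Rightarrow> (nat \<Rightarrow> nat) set" where
  "ones x S = {i \<in> S. x i = 1}"

definition ones_fraction :: "nat \<Rightarrow> (nat \<Rightarrow> nat) \<Rightarrow> ((nat \<Rightarrow> nat) \<Rightarrow> nat) \<Rightarrow> real" where
  "ones_fraction D n x =
     real (card (ones x (array_indices D n))) / real (card (array_indices D n))"

definition ie_bits :: "nat \<Rightarrow> nat" where
  "ie_bits m = nat \<lceil>log 2 (real m)\<rceil>"

datatype stored_item =
    Index nat \<comment> \<open>position of a one-valued weight within its slice\<close>
  | Delimiter nat \<comment> \<open>number of one-valued weights in a slice\<close>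
  | Dim_Size nat
  | Param real

primrec item_bits :: "nat \<Rightarrow> stored_item \<Rightarrow> nat" where
  "item_bits b (Index k) = b"
| "item_bits b (Delimiter c) = b + 1"
| "item_bits b (Dim_Size m) = 16"
| "item_bits b (Param r) = 32"

text \<open>
  Everything the index encoder stores for a layer with binary weights \<open>x\<close> and learned
  parameters \<open>a\<close>, \<open>b\<close>. A multiset suffices because only the number of stored bits matters:
  it keeps repetitions but forgets the order of the items.
\<close>

definition ie_encoding ::
  "nat \<Rightarrow> (nat \<Rightarrow> nat) \<Rightarrow> nat \<Rightarrow> real \<Rightarrow> real \<Rightarrow> ((nat \<Rightarrow> nat) \<Rightarrow> nat) \<Rightarrow> stored_item multiset" where
  "ie_encoding D n d a b x =
     (\<Sum>s\<in>slices D n d.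
        image_mset (\<lambda>i. Index (i d)) (mset_set (ones x s)) + {# Delimiter (card (ones x s)) #})
     + image_mset (\<lambda>j. Dim_Size (n j)) (mset_set {1..D})
     + {# Param a, Param b #}"

definition ie_layer_size ::
  "nat \<Rightarrow> (nat \<Rightarrow> nat) \<Rightarrow> nat \<Rightarrow> real \<Rightarrow> real \<Rightarrow> ((nat \<Rightarrow> nat) \<Rightarrow> nat) \<Rightarrow> nat" where
  "ie_layer_size D n d a b x =
     (\<Sum>t\<in>#ie_encoding D n d a b x. item_bits (ie_bits (n d)) t)"

text \<open>In the following, the first argument is the number of compressed layers.\<close>

definition ie_network_size ::
  "nat \<Rightarrow> (nat \<Rightarrow> nat) \<Rightarrow> (nat \<Rightarrow> nat \<Rightarrow> nat) \<Rightarrow> (nat \<Rightarrow> nat) \<Rightarrow> (nat \<Rightarrow> real) \<Rightarrow> (nat \<Rightarrow> real) \<Rightarrow>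
   (nat \<Rightarrow> (nat \<Rightarrow> nat) \<Rightarrow> nat) \<Rightarrow> nat" where
  "ie_network_size L D n d a b x =
     (\<Sum>l=1..L. ie_layer_size (D l) (n l) (d l) (a l) (b l) (x l))"

definition expected_ie_network_size ::
  "'a measure \<Rightarrow> nat \<Rightarrow> (nat \<Rightarrow> nat) \<Rightarrow> (nat \<Rightarrow> nat \<Rightarrow> nat) \<Rightarrow> (nat \<Rightarrow> nat) \<Rightarrow>
   (nat \<Rightarrow> real) \<Rightarrow> (nat \<Rightarrow> real) \<Rightarrow> (nat \<Rightarrow> (nat \<Rightarrow> nat) \<Rightarrow> 'a \<Rightarrow> nat) \<Rightarrow> real" where
  "expected_ie_network_size M L D n d a b w =
     (LINT \<omega>|M. real (ie_network_size L D n d a b (\<lambda>l i. w l i \<omega>)))"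

end

theory Submission
  imports Defs
begin

text \<open>
  The slices along a dimension partition the array, so the encoded size of a layer depends on the
  weights only through the total number of ones, and does so affinely. Linearity of expectation
  then reduces the claim to \<open>P(w = 1) = EC\<close> for each single weight.
\<close>

lemma finite_array_indices [simp]: "finite (array_indices D n)"
  by (simp add: array_indices_def finite_PiE)

lemma card_array_indices: "card (array_indices D n) = (\<Prod>j=1..D. n j)"
  by (simp add: array_indices_def card_PiE)

lemma fun_upd_in_array_indices:
  assumes "i \<in> array_indices D n" "d \<in> {1..D}" "k < n d"
  shows "i(d := k) \<in> array_indices D n"
  using assms unfolding array_indices_def by (auto simp: PiE_iff extensional_def)

lemma array_indices_less:
  assumes "i \<in> array_indices D n" "d \<in> {1..D}"
  shows "i d < n d"
  using assms unfolding array_indices_def by (auto simp: PiE_iff)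

text \<open>The right-hand side is the class of \<open>i\<close> under the equivalence relation of
  agreeing at every coordinate except \<open>d\<close>. Hence slices are equivalence classes: they
  cover the array, and two of them with a common element coincide.\<close>

lemma slice_eq:
  assumes "i \<in> array_indices D n" "d \<in> {1..D}"
  shows "(\<lambda>k. i(d := k)) ` {..<n d} = {j \<in> array_indices D n. \<forall>k. k \<noteq> d \<longrightarrow> j k = i k}"
proof (intro equalityI subsetI)
  fix j assume "j \<in> (\<lambda>k. i(d := k)) ` {..<n d}"
  then show "j \<in> {j \<in> array_indices D n. \<forall>k. k \<noteq> d \<longrightarrow> j k = i k}"
    using fun_upd_in_array_indices[OF assms] by auto
next
  fix j assume j: "j \<in> {j \<in> array_indices D n. \<forall>k. k \<noteq> d \<longrightarrow> j k = i k}"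
  then have "j = i(d := j d)" by auto
  moreover have "j d < n d" using j assms array_indices_less by blast
  ultimately show "j \<in> (\<lambda>k. i(d := k)) ` {..<n d}" by blast
qed

lemma finite_slices [simp]: "finite (slices D n d)"
  by (simp add: slices_def)

lemma finite_slice: "s \<in> slices D n d \<Longrightarrow> finite s"
  by (auto simp: slices_def)

text \<open>Different values \<open>k\<close> give different updates \<open>i(d := k)\<close>, so
  the parametrisation of a slice by \<open>{..<n d}\<close> is injective.\<close>

lemma card_slice: "s \<in> slices D n d \<Longrightarrow> card s = n d"
  unfolding slices_def
  by (auto intro!: card_image[THEN trans] inj_onI dest: fun_upd_eqD)

lemma Union_slices:
  assumes "d \<in> {1..D}"
  shows "\<Union>(slices D n d) = array_indices D n"
  using slice_eq[OF _ assms] unfolding slices_def by auto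

lemma slices_disjoint:
  assumes "d \<in> {1..D}" "s \<in> slices D n d" "t \<in> slices D n d" "s \<noteq> t"
  shows "s \<inter> t = {}"
  using assms slice_eq[OF _ assms(1)] unfolding slices_def by auto

text \<open>The array is partitioned into slices of equal cardinality \<open>n d\<close>. The
  product form stays within the naturals; the division by \<open>n d\<close> is done later, in the
  reals.\<close>

lemma card_slices:
  assumes "d \<in> {1..D}"
  shows "n d * card (slices D n d) = (\<Prod>j=1..D. n j)"
proof -
  have "n d * card (slices D n d) = card (\<Union>(slices D n d))"
    by (rule card_partition)
       (auto simp: Union_slices[OF assms] card_slice dest: slices_disjoint[OF assms])
  then show ?thesis by (simp add: Union_slices[OF assms] card_array_indices)
qed

text \<open>Once counts are written as sums of indicators, disjointness of the slices merges the
  double sum into one sum over their union, the whole array.\<close>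

lemma sum_card_ones_slices:
  assumes "d \<in> {1..D}"
  shows "(\<Sum>s\<in>slices D n d. card (ones x s)) = card (ones x (array_indices D n))"
proof -
  have card_ones: "card (ones x S) = (\<Sum>i\<in>S. of_bool (x i = 1))" if "finite S" for S
    using that by (simp add: ones_def Int_def)
  have "(\<Sum>s\<in>slices D n d. card (ones x s)) = (\<Sum>s\<in>slices D n d. \<Sum>i\<in>s. of_bool (x i = 1))"
    by (rule sum.cong) (auto simp: card_ones finite_slice)
  also have "\<dots> = (\<Sum>i\<in>\<Union>(slices D n d). of_bool (x i = 1))"
    using slices_disjoint[OF assms]
    by (subst sum.Union_disjoint) (auto simp: finite_slice)
  finally show ?thesis by (simp only: Union_slices[OF assms] card_ones[OF finite_array_indices])
qed

text \<open>Lets the bits of \<open>ie_encoding\<close> be counted slice by slice. For infinite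
  \<open>S\<close> both sides are 0, the outer sums taking their default values.\<close>

lemma sum_mset_image_sum:
  "(\<Sum>t\<in>#(\<Sum>s\<in>S. F s). f t) = (\<Sum>s\<in>S. \<Sum>t\<in>#F s. f t)"
  by (induction S rule: infinite_finite_induct) auto

lemma ie_layer_size_eq:
  assumes "d \<in> {1..D}"
  shows "ie_layer_size D n d a b x =
    ie_bits (n d) * card (ones x (array_indices D n))
    + (ie_bits (n d) + 1) * card (slices D n d) + 16 * D + 64"
  \<comment> \<open>The total count is split back into slices, so that both sides are sums over
    \<open>slices D n d\<close> and can be compared termwise.\<close>
  unfolding sum_card_ones_slices[OF assms, symmetric]
  by (simp add: ie_layer_size_def ie_encoding_def sum_mset_image_sum sum.distrib sum_Suc
      image_mset.compositionality comp_def sum_distrib_left mult.commute)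

text \<open>The indicator is bounded by 1, hence integrable. Its expectation depends only on the
  distribution of \<open>w\<close>, so it can be computed under the Bernoulli law.\<close>

lemma (in prob_space) bernoulli_prob_eq_1:
  fixes w :: "'a \<Rightarrow> nat"
  assumes "w \<in> measurable M (count_space {0, 1})" "0 \<le> p" "p \<le> 1"
    and "distr M (count_space UNIV) w = measure_pmf (map_pmf of_bool (bernoulli_pmf p))"
  shows "integrable M (\<lambda>\<omega>. of_bool (w \<omega> = 1) :: real)"
    and "(LINT \<omega>|M. of_bool (w \<omega> = 1)) = p"
proof -
  \<comment> \<open>The codomain is enlarged from the two-point space to all naturals, where the law
    of \<open>w\<close> is given.\<close>
  have meas: "w \<in> measurable M (count_space UNIV)"
    using measurable_compose[OF assms(1), of "\<lambda>k. k" "count_space UNIV"] by simp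
  show "integrable M (\<lambda>\<omega>. of_bool (w \<omega> = 1) :: real)"
    by (rule integrable_const_bound[where B = 1]) (use meas in auto)
  have "(LINT \<omega>|M. of_bool (w \<omega> = 1)) =
      (LINT k|distr M (count_space UNIV) w. of_bool (k = 1) :: real)"
    by (subst integral_distr[OF meas]) auto
  also have "\<dots> = p"
    using assms(2,3) by (simp add: assms(4) integral_map_pmf)
  finally show "(LINT \<omega>|M. of_bool (w \<omega> = 1)) = p" .
qed

text \<open>Integrability is recorded with the value because it justifies exchanging expectation and
  the sum over layers.\<close>

lemma (in prob_space) expected_ie_layer_size:
  fixes w :: "(nat \<Rightarrow> nat) \<Rightarrow> 'a \<Rightarrow> nat"
  assumes d: "d \<in> {1..D}" and "n d \<ge> 1" and p: "0 \<le> p" "p \<le> 1"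
    and meas: "\<And>i. i \<in> array_indices D n \<Longrightarrow> w i \<in> measurable M (count_space {0, 1})"
    and distr: "\<And>i. i \<in> array_indices D n \<Longrightarrow>
      distr M (count_space UNIV) (w i) = measure_pmf (map_pmf of_bool (bernoulli_pmf p))"
  defines "B \<equiv> real (ie_bits (n d))" and "N \<equiv> real (\<Prod>j=1..D. n j)"
  shows "integrable M (\<lambda>\<omega>. real (ie_layer_size D n d a b (\<lambda>i. w i \<omega>)))"
    and "(LINT \<omega>|M. real (ie_layer_size D n d a b (\<lambda>i. w i \<omega>))) =
      B * p * N + (B + 1) * (N / real (n d)) + 16 * real D + 32 * 2"
proof -
  let ?A = "array_indices D n"
  let ?f = "\<lambda>i \<omega>. of_bool (w i \<omega> = 1) :: real"
  have "real (n d) * real (card (slices D n d)) = N"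
    unfolding N_def card_slices[OF d, symmetric] by simp
  then have slices: "real (card (slices D n d)) = N / real (n d)"
    using \<open>n d \<ge> 1\<close> by (simp add: field_simps)
  \<comment> \<open>The random part, a sum of indicators, is separated from the delimiters,
    dimension sizes and parameters, whose cost is deterministic.\<close>
  have size: "real (ie_layer_size D n d a b (\<lambda>i. w i \<omega>)) =
      B * (\<Sum>i\<in>?A. ?f i \<omega>) + ((B + 1) * (N / real (n d)) + 16 * real D + 64)" for \<omega>
    by (simp add: ie_layer_size_eq[OF d] ones_def Int_def B_def slices distrib_right add_divide_distrib)
  note weight = bernoulli_prob_eq_1[OF meas p distr]
  have int: "integrable M (\<lambda>\<omega>. B * (\<Sum>i\<in>?A. ?f i \<omega>))"
    by (intro integrable_mult_right Bochner_Integration.integrable_sum weight)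
  show "integrable M (\<lambda>\<omega>. real (ie_layer_size D n d a b (\<lambda>i. w i \<omega>)))"
    unfolding size by (intro Bochner_Integration.integrable_add int integrable_const)
  \<comment> \<open>Each of the \<open>N\<close> positions contributes the expectation
    \<open>p\<close>.\<close>
  have "(LINT \<omega>|M. (\<Sum>i\<in>?A. ?f i \<omega>)) = N * p"
    by (subst Bochner_Integration.integral_sum) (auto simp: weight[simplified] card_array_indices N_def)
  then show "(LINT \<omega>|M. real (ie_layer_size D n d a b (\<lambda>i. w i \<omega>))) =
      B * p * N + (B + 1) * (N / real (n d)) + 16 * real D + 32 * 2"
    unfolding size by (subst Bochner_Integration.integral_add[OF int]) (simp_all add: prob_space)
qed

theorem proposition1:
  fixes M :: "'a measure"
    and L :: nat
    and D :: "nat \<Rightarrow> nat"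
    and n :: "nat \<Rightarrow> nat \<Rightarrow> nat"
    and N :: "nat \<Rightarrow> nat"
    and d :: "nat \<Rightarrow> nat"
    and \<alpha> \<beta> :: "nat \<Rightarrow> real"
    and w :: "nat \<Rightarrow> (nat \<Rightarrow> nat) \<Rightarrow> 'a \<Rightarrow> nat"
    and EC :: real
  assumes "prob_space M"
    and "0 \<le> EC" "EC \<le> 1"
    and "\<And>l j. l \<in> {1..L} \<Longrightarrow> j \<in> {1..D l} \<Longrightarrow> n l j \<ge> 1"
    and "\<And>l. l \<in> {1..L} \<Longrightarrow> N l = (\<Prod>j=1..D l. n l j)"
    and "\<And>l. l \<in> {1..L} \<Longrightarrow> d l \<in> {1..D l}"
    and "\<And>l i. l \<in> {1..L} \<Longrightarrow> i \<in> array_indices (D l) (n l) \<Longrightarrow>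
           w l i \<in> measurable M (count_space {0, 1})"
    and "\<And>l i. l \<in> {1..L} \<Longrightarrow> i \<in> array_indices (D l) (n l) \<Longrightarrow>
           distr M (count_space UNIV) (w l i) = measure_pmf (map_pmf of_bool (bernoulli_pmf EC))"
    and "\<And>l. l \<in> {1..L} \<Longrightarrow>
           AE \<omega> in M. ones_fraction (D l) (n l) (\<lambda>i. w l i \<omega>) = EC"
  shows "expected_ie_network_size M L D n d \<alpha> \<beta> w =
    (\<Sum>l=1..L. real (ie_bits (n l (d l))) * EC * real (N l)
       + (real (ie_bits (n l (d l))) + 1) * (real (N l) / real (n l (d l)))
       + 16 * real (D l) + 32 * 2)"
proof -
  interpret prob_space M by fact
  have pos: "n l (d l) \<ge> 1" if "l \<in> {1..L}" for l
    using assms(4,6) that by blast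
  have int: "integrable M (\<lambda>\<omega>. real (ie_layer_size (D l) (n l) (d l) (\<alpha> l) (\<beta> l) (\<lambda>i. w l i \<omega>)))"
    if "l \<in> {1..L}" for l
    by (rule expected_ie_layer_size(1)) (use assms pos that in auto)
  have "expected_ie_network_size M L D n d \<alpha> \<beta> w =
      (\<Sum>l=1..L. LINT \<omega>|M. real (ie_layer_size (D l) (n l) (d l) (\<alpha> l) (\<beta> l) (\<lambda>i. w l i \<omega>)))"
    unfolding expected_ie_network_size_def ie_network_size_def of_nat_sum
    by (rule Bochner_Integration.integral_sum) (rule int)
  also have "\<dots> = (\<Sum>l=1..L. real (ie_bits (n l (d l))) * EC * real (N l)
       + (real (ie_bits (n l (d l))) + 1) * (real (N l) / real (n l (d l)))
       + 16 * real (D l) + 32 * 2)"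
  proof (rule sum.cong)
    fix l assume l: "l \<in> {1..L}"
    show "(LINT \<omega>|M. real (ie_layer_size (D l) (n l) (d l) (\<alpha> l) (\<beta> l) (\<lambda>i. w l i \<omega>))) =
        real (ie_bits (n l (d l))) * EC * real (N l)
        + (real (ie_bits (n l (d l))) + 1) * (real (N l) / real (n l (d l)))
        + 16 * real (D l) + 32 * 2"
      \<comment> \<open>Replaces \<open>N l\<close> by the product of the dimension sizes, the form
        in which the layer lemma gives its value.\<close>
      unfolding assms(5)[OF l]
      by (rule expected_ie_layer_size(2)) (use assms pos l in auto)
  qed simp
  finally show ?thesis .
qed

end
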